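(* Let $d\ge1$ and let $(\mathbb Z^d,E,\mu,w)$ be the weighted nearest-neighbour lattice graph with vertex measure $\mu(x)=\sum_{y\sim x}w_{xy}$, satisfying $0<\mu_{\min}\le\mu_{\max}<\infty$ and $\inf_{x\sim y}w_{xy}>0$, with normalized Laplacian $\Delta$ and heat kernel $p(t,x,y)$. For $x\ne y$ let $$W_{\log}(x,y)=\mu(x)\mu(y)\int_0^1 p(t,x,y)\,\frac{dt}{t}.$$ Then for every $x\in\mathbb Z^d$, $$\sum_{y\neq x}W_{\log}(x,y)=\mu(x)\int_0^1\bigl(1-p(t,x,x)\mu(x)\bigr)\frac{dt}{t}.$$ Moreover, there is a constant $C>0$ (independent of $x,y$) such that $$W_{\log}(x,y)\le C\,\frac{e^{d(x,y)}}{d(x,y)^{\,d(x,y)+1}}\qquad\text{for all }x\neq y .$$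
   Context: Weighted lattice graph: vertex set $\mathbb Z^d$, with $x\sim y$ iff $|x-y|_1=1$; symmetric weights $w_{xy}=w_{yx}>0$ if $x\sim y$ and $w_{xy}=0$ otherwise (in particular $w_{xx}=0$); $\mu(x)=\sum_{y\sim x}w_{xy}$; $\mu_{\min}=\inf_x\mu(x)$, $\mu_{\max}=\sup_x\mu(x)$. $d(x,y)$ is the graph distance. The normalized Laplacian is $\Delta u(x)=\frac1{\mu(x)}\sum_{y\sim x}w_{xy}(u(y)-u(x))$, a bounded self-adjoint operator on $\ell^2(\mathbb Z^d,\mu)$. The heat kernel $p(t,x,y)$, $t\ge0$, is defined by $e^{t\Delta}u(x)=\sum_{y}p(t,x,y)u(y)\mu(y)$, i.e. $p(t,x,y)=\mu(y)^{-1}(e^{t\Delta}\mathbf 1_{\{y\}})(x)$. *)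

theory Defs
  imports "HOL-Analysis.Analysis"
begin

text \<open>
  The lattice of dimension \<open>d \<ge> 1\<close> is the type \<^typ>\<open>int ^ 'd\<close> with \<open>d = CARD('d)\<close>.
  Functions on it, and hence the space \<open>\<ell>\<^sup>2(\<mu>)\<close>, are real valued.
\<close>

definition lattice_adj :: "int ^ 'd \<Rightarrow> int ^ 'd \<Rightarrow> bool" where
  "lattice_adj x y \<longleftrightarrow> (\<Sum>i\<in>UNIV. \<bar>x $ i - y $ i\<bar>) = 1"

lemma finite_lattice_adj: "finite {y. lattice_adj x y}"
proof -
  have "{y. lattice_adj x y} \<subseteq> (\<lambda>f. \<chi> i. f i) ` (\<Pi>\<^sub>E i\<in>UNIV. {x $ i - 1 .. x $ i + 1})"
  proof
    fix y assume "y \<in> {y. lattice_adj x y}"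
    then have s: "(\<Sum>i\<in>UNIV. \<bar>x $ i - y $ i\<bar>) = 1"
      by (simp add: lattice_adj_def)
    have "\<bar>x $ i - y $ i\<bar> \<le> 1" for i
      using member_le_sum[of i UNIV "\<lambda>i. \<bar>x $ i - y $ i\<bar>"] s by simp
    then have "y $ i \<in> {x $ i - 1 .. x $ i + 1}" for i
      by (smt (verit, best) atLeastAtMost_iff)
    then have "(\<lambda>i. y $ i) \<in> (\<Pi>\<^sub>E i\<in>UNIV. {x $ i - 1 .. x $ i + 1})"
      by (auto simp: PiE_UNIV_domain)
    moreover have "y = (\<chi> i. y $ i)" by simp
    ultimately show "y \<in> (\<lambda>f. \<chi> i. f i) ` (\<Pi>\<^sub>E i\<in>UNIV. {x $ i - 1 .. x $ i + 1})"
      by (metis imageI)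
  qed
  then show ?thesis
    by (rule finite_subset) (intro finite_imageI finite_PiE; simp)
qed

text \<open>The length of a shortest path of nearest-neighbour steps from \<open>x\<close> to \<open>y\<close>.\<close>

definition graph_dist :: "int ^ 'd \<Rightarrow> int ^ 'd \<Rightarrow> nat" where
  "graph_dist x y = (LEAST n. (lattice_adj ^^ n) x y)"

definition lattice_weight :: "(int ^ 'd \<Rightarrow> int ^ 'd \<Rightarrow> real) \<Rightarrow> bool" where
  "lattice_weight w \<longleftrightarrow>
     (\<forall>x y. w x y = w y x) \<and>
     (\<forall>x y. lattice_adj x y \<longrightarrow> w x y > 0) \<and>
     (\<forall>x y. \<not> lattice_adj x y \<longrightarrow> w x y = 0)"

definition vmeasure :: "(int ^ 'd \<Rightarrow> int ^ 'd \<Rightarrow> real) \<Rightarrow> int ^ 'd \<Rightarrow> real" where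
  "vmeasure w x = (\<Sum>y | lattice_adj x y. w x y)"

text \<open>The extrema are taken in \<^typ>\<open>ereal\<close>, so that they exist without boundedness assumptions.\<close>

definition mu_min :: "(int ^ 'd \<Rightarrow> int ^ 'd \<Rightarrow> real) \<Rightarrow> ereal" where
  "mu_min w = (INF x. ereal (vmeasure w x))"

definition mu_max :: "(int ^ 'd \<Rightarrow> int ^ 'd \<Rightarrow> real) \<Rightarrow> ereal" where
  "mu_max w = (SUP x. ereal (vmeasure w x))"

definition laplacian ::
  "(int ^ 'd \<Rightarrow> int ^ 'd \<Rightarrow> real) \<Rightarrow> (int ^ 'd \<Rightarrow> real) \<Rightarrow> int ^ 'd \<Rightarrow> real" where
  "laplacian w u x = 1 / vmeasure w x * (\<Sum>y | lattice_adj x y. w x y * (u y - u x))"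

definition l2 :: "('a \<Rightarrow> real) \<Rightarrow> ('a \<Rightarrow> real) set" where
  "l2 \<mu> = {u. (\<lambda>x. (u x)\<^sup>2 * \<mu> x) summable_on UNIV}"

definition l2_norm :: "('a \<Rightarrow> real) \<Rightarrow> ('a \<Rightarrow> real) \<Rightarrow> real" where
  "l2_norm \<mu> u = sqrt (\<Sum>\<^sub>\<infinity>x. (u x)\<^sup>2 * \<mu> x)"

text \<open>
  The exponential \<open>e\<^bsup>t\<Delta>\<^esup> u = (\<Sum>n. t\<^sup>n / n! \<Delta>\<^sup>n u)\<close> for \<open>u \<in> \<ell>\<^sup>2(\<mu>)\<close>, the series converging in the norm
  of \<open>\<ell>\<^sup>2(\<mu>)\<close>. As \<open>\<Delta>\<close> is bounded on \<open>\<ell>\<^sup>2(\<mu>)\<close>, the limit exists; it is unique because \<open>\<mu> > 0\<close>.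
\<close>

definition heat_semigroup ::
  "(int ^ 'd \<Rightarrow> int ^ 'd \<Rightarrow> real) \<Rightarrow> real \<Rightarrow> (int ^ 'd \<Rightarrow> real) \<Rightarrow> int ^ 'd \<Rightarrow> real" where
  "heat_semigroup w t u =
     (THE v. v \<in> l2 (vmeasure w) \<and>
        (\<lambda>N. l2_norm (vmeasure w)
               (\<lambda>x. (\<Sum>n<N. t ^ n / fact n * (laplacian w ^^ n) u x) - v x))
          \<longlonglongrightarrow> 0)"

definition heat_kernel ::
  "(int ^ 'd \<Rightarrow> int ^ 'd \<Rightarrow> real) \<Rightarrow> real \<Rightarrow> int ^ 'd \<Rightarrow> int ^ 'd \<Rightarrow> real" where
  "heat_kernel w t x y = inverse (vmeasure w y) * heat_semigroup w t (indicator {y}) x"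

definition W_log ::
  "(int ^ 'd \<Rightarrow> int ^ 'd \<Rightarrow> real) \<Rightarrow> int ^ 'd \<Rightarrow> int ^ 'd \<Rightarrow> real" where
  "W_log w x y = vmeasure w x * vmeasure w y * (LBINT t:{0<..1}. heat_kernel w t x y / t)"

end

theory Submission
  imports Defs
begin

text \<open>
The normalized Laplacian is \<open>\<Delta> = P - I\<close>, where \<open>P\<close> is the transition operator of the random walk
that jumps from \<open>x\<close> to \<open>y\<close> with probability \<open>w\<^sub>x\<^sub>y / \<mu>(x)\<close>. Hence \<open>e\<^bsup>t\<Delta>\<^esup> = e\<^bsup>-t\<^esup> e\<^bsup>tP\<^esup>\<close>, and the heat
kernel is the law of the walk observed after a Poisson number of steps:
\<open>\<mu>(y) p(t,x,y) = e\<^bsup>-t\<^esup> (\<Sum>n. t\<^sup>n / n! P\<^sup>n(x,y))\<close> (lemma \<open>heat_kernel_eq\<close>).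

Everything then rests on one estimate for the Poisson averages \<open>e\<^bsup>-t\<^esup> (\<Sum>n. t\<^sup>n / n! a\<^sub>n)\<close> of a sequence in
\<open>[0,1]\<close>: if \<open>a\<^sub>n = 0\<close> for \<open>n < m\<close>, the average is at most the probability of at least \<open>m\<close> jumps up
to time \<open>t\<close>, which is at most \<open>t\<^sup>m / m!\<close>. For \<open>m \<ge> 1\<close>, integrating against \<open>dt/t\<close> over \<open>(0,1]\<close> gives at
most \<open>1 / (m m!)\<close> (lemma \<open>poisson_avg_integral\<close>). This is used three times.

\<^item> \<open>P\<^sup>n(x,y)\<close> and \<open>1 - P\<^sup>n(x,x)\<close> with \<open>m = 1\<close>: both integrals in the proposition exist.

\<^item> \<open>1 - (\<Sum>y\<in>F \<union> {x}. P\<^sup>n(x,y))\<close>, the probability that the walk is outside the finite set \<open>F \<union> {x}\<close>. Its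
integral, times \<open>\<mu>(x)\<close>, is exactly the error made when the sum over \<open>y \<noteq> x\<close> is restricted to \<open>F\<close> (lemma
\<open>W_log_remainder\<close>). Once \<open>F\<close> contains every point other than \<open>x\<close> that is reachable in fewer than \<open>m\<close>
steps, the error is at most \<open>\<mu>(x) / (m m!)\<close>. This proves the summation formula without exchanging an
infinite sum and an integral.

\<^item> \<open>P\<^sup>n(x,y)\<close> with \<open>m = d(x,y)\<close>, as the walk cannot reach \<open>y\<close> any earlier. Now
\<open>1 / (m m!) \<le> e\<^sup>m / m\<^bsup>m+1\<^esup>\<close>, because \<open>m\<^sup>m / m!\<close> is a single term of the series of \<open>e\<^sup>m\<close>. So
\<open>C = \<mu>\<^sub>m\<^sub>a\<^sub>x\<close> works.

The analytic point is the identification of \<open>e\<^bsup>t\<Delta>\<^esup>\<close>, which is a limit in \<open>\<ell>\<^sup>2(\<mu>)\<close>, with the pointwise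
series. The functions \<open>\<Delta>\<^sup>n 1\<^bsub>{y}\<^esub>\<close> have supremum at most \<open>2\<^sup>n\<close> and \<open>\<ell>\<^sup>1(\<mu>)\<close>-norm at most \<open>2\<^sup>n \<mu>(y)\<close>, the latter
because the walk is reversible. As \<open>\<Sum>f\<^sup>2\<mu> \<le> sup\<bar>f\<bar> \<Sum>\<bar>f\<bar>\<mu>\<close>, the remainders of the series tend to \<open>0\<close> in
\<open>\<ell>\<^sup>2(\<mu>)\<close> (lemma \<open>heat_series_l2_remainder\<close>).
\<close>

section \<open>Poisson averages\<close>

text \<open>
The expectation of \<open>a\<^sub>N\<close> for a Poisson variable \<open>N\<close> of mean \<open>t\<close>.
\<close>

definition poisson_avg :: "real \<Rightarrow> (nat \<Rightarrow> real) \<Rightarrow> real" where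
  "poisson_avg t a = exp (- t) * (\<Sum>n. t ^ n / fact n * a n)"

lemma exp_series_sums: "(\<lambda>n. t ^ n / fact n) sums exp (t::real)"
  using exp_converges[of t] by (simp add: scaleR_conv_of_real field_simps)

lemma summable_exp_series: "summable (\<lambda>n. t ^ n / fact n :: real)"
  using exp_series_sums by (rule sums_summable)

lemma summable_exp_series_bounded:
  fixes t :: real
  assumes "\<And>n. \<bar>a n\<bar> \<le> c ^ n"
  shows "summable (\<lambda>n. \<bar>t ^ n / fact n * a n\<bar>)"
proof (rule summable_comparison_test')
  show "summable (\<lambda>n. (\<bar>t\<bar> * c) ^ n / fact n)"
    by (rule summable_exp_series)
  show "norm \<bar>t ^ n / fact n * a n\<bar> \<le> (\<bar>t\<bar> * c) ^ n / fact n" if "n \<ge> 0" for n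
    using mult_left_mono[OF assms[of n], of "\<bar>t\<bar> ^ n / fact n"]
    by (simp add: abs_mult power_abs power_mult_distrib)
qed

lemma summable_poisson:
  fixes t :: real
  assumes "\<And>n. 0 \<le> a n" "\<And>n. a n \<le> 1"
  shows "summable (\<lambda>n. t ^ n / fact n * a n)"
  by (rule summable_rabs_cancel, rule summable_exp_series_bounded[where c = 1])
     (simp add: assms)

lemma poisson_avg_measurable [measurable]: "(\<lambda>t. poisson_avg t a) \<in> borel_measurable borel"
  unfolding poisson_avg_def by measurable

lemma poisson_avg_sum:
  assumes "\<And>i n. i \<in> I \<Longrightarrow> 0 \<le> a i n" "\<And>i n. i \<in> I \<Longrightarrow> a i n \<le> 1"
  shows "poisson_avg t (\<lambda>n. \<Sum>i\<in>I. a i n) = (\<Sum>i\<in>I. poisson_avg t (a i))"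
proof -
  have "(\<Sum>n. \<Sum>i\<in>I. t ^ n / fact n * a i n) = (\<Sum>i\<in>I. \<Sum>n. t ^ n / fact n * a i n)"
    by (intro suminf_sum summable_poisson assms)
  then show ?thesis
    by (simp add: poisson_avg_def sum_distrib_left)
qed

lemma poisson_avg_compl:
  assumes "\<And>n. 0 \<le> a n" "\<And>n. a n \<le> 1"
  shows "poisson_avg t (\<lambda>n. 1 - a n) = 1 - poisson_avg t a"
proof -
  have "(\<Sum>n. t ^ n / fact n * (1 - a n)) = exp t - (\<Sum>n. t ^ n / fact n * a n)"
    using suminf_diff[OF summable_exp_series summable_poisson[of a t, OF assms], of t]
    unfolding sums_unique[OF exp_series_sums[of t]] by (simp only: right_diff_distrib mult_1_right)
  then have "poisson_avg t (\<lambda>n. 1 - a n) = exp (- t) * exp t - poisson_avg t a"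
    by (simp only: poisson_avg_def right_diff_distrib)
  then show ?thesis
    by (simp flip: exp_add)
qed

lemma poisson_avg_nonneg:
  assumes "0 \<le> t" "\<And>n. 0 \<le> a n" "\<And>n. a n \<le> 1"
  shows "0 \<le> poisson_avg t a"
  unfolding poisson_avg_def
  by (intro mult_nonneg_nonneg suminf_nonneg summable_poisson assms) (auto simp: assms)

text \<open>
Only terms with \<open>n \<ge> m\<close> contribute, and \<open>(n + m)! \<ge> n! m!\<close> lets \<open>t\<^sup>m / m!\<close> be taken out of what is left
of the series of \<open>e\<^sup>t\<close>.
\<close>

lemma poisson_avg_le:
  assumes "0 \<le> t" "\<And>n. 0 \<le> a n" "\<And>n. a n \<le> 1" and zero: "\<And>n. n < m \<Longrightarrow> a n = 0"
  shows "poisson_avg t a \<le> t ^ m / fact m"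
proof -
  let ?f = "\<lambda>n. t ^ n / fact n * a n"
  have sf: "summable ?f"
    by (rule summable_poisson) (fact assms)+
  have shifted: "?f (n + m) \<le> t ^ m / fact m * (t ^ n / fact n)" for n
  proof -
    have "(fact m * fact n :: nat) \<le> fact (n + m)"
      by (rule dvd_imp_le) (auto simp: fact_fact_dvd_fact add.commute)
    then have "(fact m * fact n :: real) \<le> fact (n + m)"
      by (metis of_nat_fact of_nat_le_iff of_nat_mult)
    then have "t ^ (n + m) / fact (n + m) \<le> t ^ (n + m) / (fact m * fact n)"
      using assms(1) by (intro divide_left_mono) auto
    moreover have "?f (n + m) \<le> t ^ (n + m) / fact (n + m) * 1"
      using assms by (intro mult_left_mono) auto
    ultimately show ?thesis
      by (simp add: power_add mult.commute)
  qed
  have "suminf ?f = (\<Sum>n. ?f (n + m))"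
    using suminf_split_initial_segment[OF sf, of m] zero by simp
  also have "\<dots> \<le> (\<Sum>n. t ^ m / fact m * (t ^ n / fact n))"
    by (intro suminf_le shifted summable_mult summable_exp_series summable_ignore_initial_segment sf)
  also have "\<dots> = t ^ m / fact m * exp t"
    using sums_unique[OF sums_mult[OF exp_series_sums[of t]], of "t ^ m / fact m"] by simp
  finally have "poisson_avg t a \<le> exp (- t) * (t ^ m / fact m * exp t)"
    unfolding poisson_avg_def by (intro mult_left_mono) auto
  also have "\<dots> = t ^ m / fact m"
    by (simp add: exp_minus field_simps)
  finally show ?thesis .
qed

lemma poisson_avg_integral:
  assumes a: "\<And>n. 0 \<le> a n" "\<And>n. a n \<le> 1" and zero: "\<And>n. n < m \<Longrightarrow> a n = 0" and m: "0 < m"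
  shows "set_integrable lborel {0<..1} (\<lambda>t. poisson_avg t a / t)"
    and "0 \<le> (LBINT t:{0<..1}. poisson_avg t a / t)"
    and "(LBINT t:{0<..1}. poisson_avg t a / t) \<le> 1 / (real m * fact m)"
proof -
  let ?g = "\<lambda>t::real. t ^ (m - 1) / fact m"
  have le: "poisson_avg t a / t \<le> ?g t" if "t \<in> {0<..1}" for t
    using poisson_avg_le[of t a m] that a zero m
    by (cases m) (auto simp: field_simps)
  have nonneg: "0 \<le> poisson_avg t a / t" if "t \<in> {0<..1}" for t
    using poisson_avg_nonneg[of t a] that a by auto
  have g01: "set_integrable lborel {0..1} ?g"
    unfolding set_integrable_def
    by (rule borel_integrable_compact) (auto intro!: continuous_intros)
  then have g: "set_integrable lborel {0<..1} ?g"
    by (rule set_integrable_subset) auto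
  show int: "set_integrable lborel {0<..1} (\<lambda>t. poisson_avg t a / t)"
  proof (rule set_integrable_bound[OF g])
    show "set_borel_measurable lborel {0<..1} (\<lambda>t. poisson_avg t a / t)"
      unfolding set_borel_measurable_def by measurable
    show "AE t in lborel. t \<in> {0<..1} \<longrightarrow> norm (poisson_avg t a / t) \<le> norm (?g t)"
      using le nonneg by (intro AE_I2) fastforce
  qed
  show "0 \<le> (LBINT t:{0<..1}. poisson_avg t a / t)"
    unfolding set_lebesgue_integral_def
    using nonneg by (intro Bochner_Integration.integral_nonneg) (auto simp: indicator_def)
  have "(LBINT t:{0<..1}. poisson_avg t a / t) \<le> (LBINT t:{0<..1}. ?g t)"
    by (rule set_integral_mono[OF int g le])
  also have "\<dots> \<le> (LBINT t:{0..1}. ?g t)"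
    using g g01 unfolding set_lebesgue_integral_def set_integrable_def
    by (intro integral_mono) (auto simp: indicator_def)
  also have "\<dots> = (LBINT t. t ^ (m - 1) * indicator {0..1} t) / fact m"
    unfolding set_lebesgue_integral_def
    by (subst integral_divide_zero[symmetric]) (simp add: mult.commute)
  also have "\<dots> = 1 / (real m * fact m)"
    using m by (subst integral_power) auto
  finally show "(LBINT t:{0<..1}. poisson_avg t a / t) \<le> 1 / (real m * fact m)" .
qed

section \<open>Binomial sums\<close>

text \<open>
Pascal's rule: the \<open>n\<close>-th power of the forward difference, expanded binomially.
\<close>

lemma binomial_difference:
  fixes a :: "nat \<Rightarrow> real"
  shows "(\<Sum>i\<le>n. real (n choose i) * (-1) ^ (n - i) * (a (Suc i) - a i)) =
         (\<Sum>i\<le>Suc n. real (Suc n choose i) * (-1) ^ (Suc n - i) * a i)"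
proof -
  have "(\<Sum>i\<le>Suc n. real (Suc n choose i) * (-1) ^ (Suc n - i) * a i) =
      (-1) ^ Suc n * a 0 + (\<Sum>i\<le>n. real (n choose i) * (-1) ^ (n - i) * a (Suc i)) +
      (\<Sum>i\<le>n. real (n choose Suc i) * (-1) ^ (n - i) * a (Suc i))"
    by (subst sum.atMost_Suc_shift) (simp add: algebra_simps sum.distrib)
  also have "(\<Sum>i\<le>n. real (n choose Suc i) * (-1) ^ (n - i) * a (Suc i)) =
      (\<Sum>i<n. real (n choose Suc i) * (-1) ^ (n - i) * a (Suc i))"
    by (simp add: lessThan_Suc_atMost[symmetric])
  also have "\<dots> = - (\<Sum>i<n. real (n choose Suc i) * (-1) ^ (n - Suc i) * a (Suc i))"
    unfolding sum_negf[symmetric]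
    by (intro sum.cong refl) (simp add: Suc_diff_Suc[symmetric])
  also have "(\<Sum>i<n. real (n choose Suc i) * (-1) ^ (n - Suc i) * a (Suc i)) =
      (\<Sum>i\<le>n. real (n choose i) * (-1) ^ (n - i) * a i) - (-1) ^ n * a 0"
    by (simp add: lessThan_Suc_atMost[symmetric] sum.lessThan_Suc_shift del: sum.lessThan_Suc)
  finally show ?thesis
    by (simp add: algebra_simps sum_subtractf)
qed

lemma sum_binomial_real: "(\<Sum>i\<le>n. real (n choose i)) = 2 ^ n"
  using choose_row_sum[of n] by (metis of_nat_numeral of_nat_power of_nat_sum)

section \<open>Weighted square-summable functions\<close>

lemma l2_norm_le:
  assumes "\<And>x. 0 \<le> \<mu> x" "0 \<le> B"
    and "\<And>F. finite F \<Longrightarrow> (\<Sum>x\<in>F. (f x)\<^sup>2 * \<mu> x) \<le> B\<^sup>2"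
  shows "f \<in> l2 \<mu>" "l2_norm \<mu> f \<le> B"
proof -
  have s: "(\<lambda>x. (f x)\<^sup>2 * \<mu> x) summable_on UNIV"
    by (rule nonneg_bounded_partial_sums_imp_summable_on[where C = "B\<^sup>2"])
       (auto simp: assms intro!: eventually_finite_subsets_at_top_weakI)
  then show "f \<in> l2 \<mu>"
    by (simp add: l2_def)
  show "l2_norm \<mu> f \<le> B"
    unfolding l2_norm_def using assms
    by (intro real_le_lsqrt infsum_le_finite_sums s infsum_nonneg) auto
qed

lemma l2_pointwise_le:
  assumes "f \<in> l2 \<mu>" "\<And>x. 0 \<le> \<mu> x"
  shows "\<bar>f x\<bar> * sqrt (\<mu> x) \<le> l2_norm \<mu> f"
proof -
  have "(\<Sum>x\<in>{x}. (f x)\<^sup>2 * \<mu> x) \<le> (\<Sum>\<^sub>\<infinity>x. (f x)\<^sup>2 * \<mu> x)"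
    using assms by (intro finite_sum_le_infsum) (auto simp: l2_def)
  then show ?thesis
    using real_sqrt_le_mono[of "(f x)\<^sup>2 * \<mu> x"] by (simp add: l2_norm_def real_sqrt_mult)
qed

lemma l2_diff:
  assumes "f \<in> l2 \<mu>" "g \<in> l2 \<mu>" "\<And>x. 0 \<le> \<mu> x"
  shows "(\<lambda>x. f x - g x) \<in> l2 \<mu>"
proof -
  have "(\<lambda>x. 2 * ((f x)\<^sup>2 * \<mu> x) + 2 * ((g x)\<^sup>2 * \<mu> x)) summable_on UNIV"
    using assms by (intro summable_on_add summable_on_cmult_right) (auto simp: l2_def)
  moreover have "(f x - g x)\<^sup>2 * \<mu> x \<le> 2 * ((f x)\<^sup>2 * \<mu> x) + 2 * ((g x)\<^sup>2 * \<mu> x)" for x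
  proof -
    have "(f x - g x)\<^sup>2 \<le> 2 * (f x)\<^sup>2 + 2 * (g x)\<^sup>2"
      using zero_le_power2[of "f x + g x"] by (simp add: power2_eq_square algebra_simps)
    from mult_right_mono[OF this assms(3)[of x]] show ?thesis
      by (simp add: algebra_simps)
  qed
  ultimately show ?thesis
    unfolding l2_def mem_Collect_eq
    by (rule summable_on_comparison_test) (auto simp: assms)
qed

section \<open>The nearest-neighbour random walk\<close>

text \<open>
The kernel \<open>P\<^sup>n(x,y)\<close>, with the recursion on the first step.
\<close>

primrec walk_prob ::
  "(int ^ 'd \<Rightarrow> int ^ 'd \<Rightarrow> real) \<Rightarrow> nat \<Rightarrow> int ^ 'd \<Rightarrow> int ^ 'd \<Rightarrow> real" where
  "walk_prob w 0 x y = of_bool (x = y)"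
| "walk_prob w (Suc n) x y = (\<Sum>z | lattice_adj x z. w x z * walk_prob w n z y) / vmeasure w x"

locale positive_lattice_weight =
  fixes w :: "int ^ 'd \<Rightarrow> int ^ 'd \<Rightarrow> real"
  assumes weight: "lattice_weight w"
    and vmeasure_pos: "\<And>x. 0 < vmeasure w x"
begin

lemma weight_sym: "w x y = w y x"
  using weight by (auto simp: lattice_weight_def)

lemma weight_nonneg: "0 \<le> w x y"
  using weight by (metis lattice_weight_def less_eq_real_def order_refl)

lemma adj_sym: "lattice_adj x y = lattice_adj y x"
  by (simp add: lattice_adj_def abs_minus_commute)

lemma vmeasure_nonneg: "0 \<le> vmeasure w x"
  using vmeasure_pos less_imp_le by blast

lemma walk_prob_nonneg: "0 \<le> walk_prob w n x y"
  by (induction n arbitrary: x)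
     (auto intro!: divide_nonneg_nonneg sum_nonneg mult_nonneg_nonneg weight_nonneg vmeasure_nonneg)

lemma sum_walk_prob_Suc:
  "(\<Sum>y\<in>F. walk_prob w (Suc n) x y) =
     (\<Sum>z | lattice_adj x z. w x z * (\<Sum>y\<in>F. walk_prob w n z y)) / vmeasure w x"
  unfolding walk_prob.simps sum_divide_distrib[symmetric] sum_distrib_left
  by (subst sum.swap) (rule refl)

lemma sum_walk_prob_le_1: "finite F \<Longrightarrow> (\<Sum>y\<in>F. walk_prob w n x y) \<le> 1"
proof (induction n arbitrary: x)
  case (Suc n)
  have "(\<Sum>z | lattice_adj x z. w x z * (\<Sum>y\<in>F. walk_prob w n z y)) \<le>
        (\<Sum>z | lattice_adj x z. w x z * 1)"
    by (intro sum_mono mult_left_mono Suc weight_nonneg)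
  then show ?case
    using vmeasure_pos[of x] unfolding sum_walk_prob_Suc by (simp add: vmeasure_def)
qed (auto simp: of_bool_def)

lemma walk_prob_le_1: "walk_prob w n x y \<le> 1"
  using sum_walk_prob_le_1[of "{y}" n x] by simp

text \<open>
The walk makes nearest-neighbour steps, so after \<open>n\<close> steps it still lies in a finite set.
\<close>

lemma ex_finite_walk_range:
  "\<exists>S. finite S \<and> (\<forall>F. finite F \<longrightarrow> S \<subseteq> F \<longrightarrow> (\<Sum>y\<in>F. walk_prob w n x y) = 1)"
proof (induction n arbitrary: x)
  case 0
  then show ?case
    by (intro exI[of _ "{x}"]) (auto simp: of_bool_def)
next
  case (Suc n)
  have "\<forall>z. \<exists>S. finite S \<and> (\<forall>F. finite F \<longrightarrow> S \<subseteq> F \<longrightarrow> (\<Sum>y\<in>F. walk_prob w n z y) = 1)"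
    using Suc.IH by (rule allI)
  from choice[OF this] obtain S where "\<forall>z. finite (S z) \<and>
      (\<forall>F. finite F \<longrightarrow> S z \<subseteq> F \<longrightarrow> (\<Sum>y\<in>F. walk_prob w n z y) = 1)"
    by (rule exE)
  then have S: "finite (S z)"
    "finite F \<Longrightarrow> S z \<subseteq> F \<Longrightarrow> (\<Sum>y\<in>F. walk_prob w n z y) = 1" for z F
    by auto
  let ?S = "\<Union>z \<in> {z. lattice_adj x z}. S z"
  have "(\<Sum>y\<in>F. walk_prob w (Suc n) x y) = 1" if "finite F" "?S \<subseteq> F" for F
  proof -
    have "(\<Sum>z | lattice_adj x z. w x z * (\<Sum>y\<in>F. walk_prob w n z y)) = vmeasure w x"
      unfolding vmeasure_def using that S(2) by (intro sum.cong refl) (auto simp: UN_subset_iff)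
    then show ?thesis
      unfolding sum_walk_prob_Suc using vmeasure_pos[of x] by simp
  qed
  then show ?case
    using finite_lattice_adj S(1) by (intro exI[of _ ?S]) auto
qed

text \<open>
The recursion on the last step; reversibility is obtained by comparing it with the one on the first.
\<close>

lemma walk_prob_Suc_right:
  "walk_prob w (Suc n) x y =
     (\<Sum>z | lattice_adj y z. walk_prob w n x z * w z y / vmeasure w z)"
proof (induction n arbitrary: x)
  case 0
  have "(\<Sum>z | lattice_adj x z. w x z * of_bool (z = y)) =
      (\<Sum>z | lattice_adj x z. if z = y then w x y else 0)"
    by (intro sum.cong) auto
  also have "\<dots> = (if lattice_adj x y then w x y else 0)"
    by (simp add: sum.delta finite_lattice_adj)
  finally have "(\<Sum>z | lattice_adj x z. w x z * of_bool (z = y)) =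
      (if lattice_adj x y then w x y else 0)" .
  moreover have "(\<Sum>z | lattice_adj y z. of_bool (x = z) * w z y / vmeasure w z) =
      (\<Sum>z | lattice_adj y z. if z = x then w x y / vmeasure w x else 0)"
    by (intro sum.cong) auto
  moreover have "\<dots> = (if lattice_adj x y then w x y / vmeasure w x else 0)"
    by (simp add: sum.delta finite_lattice_adj adj_sym[of x y])
  ultimately show ?case by simp
next
  case (Suc n)
  have "walk_prob w (Suc (Suc n)) x y = (\<Sum>u | lattice_adj x u. \<Sum>z | lattice_adj y z.
      w x u * walk_prob w n u z * w z y / vmeasure w z / vmeasure w x)"
    by (subst walk_prob.simps(2), unfold Suc.IH)
       (simp add: sum_distrib_left sum_divide_distrib mult.assoc)
  also have "\<dots> = (\<Sum>z | lattice_adj y z. walk_prob w (Suc n) x z * w z y / vmeasure w z)"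
    by (subst sum.swap)
       (simp add: sum_distrib_left sum_distrib_right sum_divide_distrib mult_ac)
  finally show ?case .
qed

text \<open>
The walk is reversible with respect to \<open>\<mu>\<close> because \<open>w\<close> is symmetric. This turns the row sums
\<open>\<Sum>x. P\<^sup>n(y,x) = 1\<close> into the column sums \<open>\<Sum>x. \<mu>(x) P\<^sup>n(x,y) = \<mu>(y)\<close>.
\<close>

lemma walk_prob_reversible:
  "vmeasure w x * walk_prob w n x y = vmeasure w y * walk_prob w n y x"
proof (induction n arbitrary: x)
  case (Suc n)
  have "vmeasure w x * walk_prob w (Suc n) x y = (\<Sum>z | lattice_adj x z. w x z * walk_prob w n z y)"
    using vmeasure_pos[of x] by simp
  also have "\<dots> = (\<Sum>z | lattice_adj x z. vmeasure w y * (walk_prob w n y z * w z x / vmeasure w z))"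
  proof (intro sum.cong refl)
    fix z
    have "walk_prob w n z y = vmeasure w y * walk_prob w n y z / vmeasure w z"
      using Suc.IH[of z] vmeasure_pos[of z] by (simp add: field_simps)
    then show "w x z * walk_prob w n z y = vmeasure w y * (walk_prob w n y z * w z x / vmeasure w z)"
      by (simp add: weight_sym[of x z])
  qed
  also have "\<dots> = vmeasure w y * walk_prob w (Suc n) y x"
    unfolding walk_prob_Suc_right by (simp add: sum_distrib_left)
  finally show ?case .
qed auto

lemma walk_prob_path: "walk_prob w n x y \<noteq> 0 \<Longrightarrow> (lattice_adj ^^ n) x y"
proof (induction n arbitrary: x)
  case (Suc n)
  then have "(\<Sum>z | lattice_adj x z. w x z * walk_prob w n z y) \<noteq> 0"
    by auto
  then obtain z where "z \<in> {z. lattice_adj x z}" "w x z * walk_prob w n z y \<noteq> 0"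
    by (rule sum.not_neutral_contains_not_neutral)
  then have "lattice_adj x z" "walk_prob w n z y \<noteq> 0"
    by auto
  with Suc.IH show ?case
    by (meson relpowp_Suc_I2)
qed auto

lemma walk_prob_eq_0:
  assumes "n < graph_dist x y"
  shows "walk_prob w n x y = 0"
  using assms walk_prob_path[of n x y] not_less_Least unfolding graph_dist_def by blast

section \<open>The heat semigroup as a Poissonised random walk\<close>

text \<open>
Since \<open>\<Delta> = P - I\<close> and the two operators commute, this is the binomial expansion of \<open>(P - I)\<^sup>n\<close>.
\<close>

lemma laplacian_power_indicator:
  "(laplacian w ^^ n) (indicator {y}) x =
     (\<Sum>i\<le>n. real (n choose i) * (-1) ^ (n - i) * walk_prob w i x y)"
proof (induction n arbitrary: x)
  case 0
  then show ?case by (simp add: indicator_def)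
next
  case (Suc n)
  have lap: "laplacian w u x = (\<Sum>z | lattice_adj x z. w x z * u z) / vmeasure w x - u x" for u
  proof -
    have "(\<Sum>z | lattice_adj x z. w x z * (u z - u x)) =
        (\<Sum>z | lattice_adj x z. w x z * u z) - vmeasure w x * u x"
      by (simp add: vmeasure_def right_diff_distrib sum_subtractf sum_distrib_right)
    then show ?thesis
      using vmeasure_pos[of x] by (simp add: laplacian_def field_simps)
  qed
  define c where "c i = real (n choose i) * (-1) ^ (n - i)" for i
  have "(laplacian w ^^ Suc n) (indicator {y}) x =
      (\<Sum>z | lattice_adj x z. w x z * (\<Sum>i\<le>n. c i * walk_prob w i z y)) / vmeasure w x
      - (\<Sum>i\<le>n. c i * walk_prob w i x y)"
    by (simp add: lap Suc.IH c_def)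
  also have "(\<Sum>z | lattice_adj x z. w x z * (\<Sum>i\<le>n. c i * walk_prob w i z y)) / vmeasure w x =
      (\<Sum>i\<le>n. c i * walk_prob w (Suc i) x y)"
    unfolding walk_prob.simps sum_distrib_left times_divide_eq_right sum_divide_distrib
    by (subst sum.swap) (simp add: mult.left_commute)
  finally show ?case
    using binomial_difference[of n "\<lambda>i. walk_prob w i x y"]
    by (simp only: c_def sum_subtractf right_diff_distrib)
qed

text \<open>
\<open>e\<^bsup>t(P - I)\<^esup> = e\<^bsup>tP\<^esup> e\<^bsup>-t\<^esup>\<close>, read off pointwise: the Cauchy product of the series of \<open>t\<^sup>k / k! P\<^sup>k(x,y)\<close> and of
\<open>(-t)\<^sup>k / k!\<close> reproduces the binomial expansion.
\<close>

lemma heat_series_sums: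
  "(\<lambda>n. t ^ n / fact n * (laplacian w ^^ n) (indicator {y}) x) sums
     poisson_avg t (\<lambda>n. walk_prob w n x y)"
proof -
  define a where "a k = t ^ k / fact k * walk_prob w k x y" for k
  define b where "b k = (- t) ^ k / fact k" for k
  have "summable (\<lambda>k. norm (a k))" "summable (\<lambda>k. norm (b k))"
    using summable_exp_series_bounded[of "\<lambda>k. walk_prob w k x y" 1 t]
      summable_exp_series_bounded[of "\<lambda>k. 1" 1 "- t"]
    by (auto simp: a_def b_def walk_prob_nonneg walk_prob_le_1)
  from Cauchy_product_sums[OF this]
  have "(\<lambda>n. \<Sum>i\<le>n. a i * b (n - i)) sums ((\<Sum>k. a k) * (\<Sum>k. b k))" .
  moreover have "(\<Sum>i\<le>n. a i * b (n - i)) =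
      t ^ n / fact n * (laplacian w ^^ n) (indicator {y}) x" for n
  proof -
    have "a i * b (n - i) =
        t ^ n / fact n * (real (n choose i) * (-1) ^ (n - i) * walk_prob w i x y)" if "i \<le> n" for i
    proof -
      have "(- t) ^ (n - i) = (-1) ^ (n - i) * t ^ (n - i)"
        by (rule power_minus)
      moreover have "t ^ i * t ^ (n - i) = t ^ n"
        using that by (simp flip: power_add)
      ultimately show ?thesis
        using that by (simp add: a_def b_def binomial_fact field_simps)
    qed
    then show ?thesis
      by (simp add: laplacian_power_indicator sum_distrib_left)
  qed
  moreover have "(\<Sum>k. b k) = exp (- t)"
    unfolding b_def using exp_series_sums by (rule sums_unique[symmetric])
  ultimately show ?thesis
    by (simp add: poisson_avg_def a_def mult.commute)
qed

lemma abs_laplacian_power_indicator_le: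
  "\<bar>(laplacian w ^^ n) (indicator {y}) x\<bar> \<le> (\<Sum>i\<le>n. real (n choose i) * walk_prob w i x y)"
  unfolding laplacian_power_indicator
  by (rule order_trans[OF sum_abs], rule sum_mono)
     (simp add: abs_mult power_abs walk_prob_nonneg)

lemma laplacian_power_indicator_sup:
  "\<bar>(laplacian w ^^ n) (indicator {y}) x\<bar> \<le> 2 ^ n"
proof -
  have "(\<Sum>i\<le>n. real (n choose i) * walk_prob w i x y) \<le> (\<Sum>i\<le>n. real (n choose i) * 1)"
    by (intro sum_mono mult_left_mono walk_prob_le_1) auto
  then show ?thesis
    using abs_laplacian_power_indicator_le[of n y x] by (simp add: sum_binomial_real)
qed

text \<open>
\<open>\<bar>\<Delta>\<^sup>n 1\<^bsub>{y}\<^esub>\<bar>\<close> is dominated by \<open>(P + I)\<^sup>n 1\<^bsub>{y}\<^esub>\<close>, and by reversibility \<open>P\<close> preserves the \<open>\<mu>\<close>-integral. Bounding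
all finite partial sums is the form in which the \<open>\<ell>\<^sup>2\<close> norm is later estimated.
\<close>

lemma laplacian_power_indicator_l1:
  assumes "finite F"
  shows "(\<Sum>x\<in>F. \<bar>(laplacian w ^^ n) (indicator {y}) x\<bar> * vmeasure w x) \<le> 2 ^ n * vmeasure w y"
proof -
  have "(\<Sum>x\<in>F. \<bar>(laplacian w ^^ n) (indicator {y}) x\<bar> * vmeasure w x) \<le>
      (\<Sum>x\<in>F. (\<Sum>i\<le>n. real (n choose i) * walk_prob w i x y) * vmeasure w x)"
    by (intro sum_mono mult_right_mono abs_laplacian_power_indicator_le vmeasure_nonneg)
  also have "\<dots> = (\<Sum>x\<in>F. \<Sum>i\<le>n. real (n choose i) * (vmeasure w y * walk_prob w i y x))"
    by (intro sum.cong refl)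
       (simp add: walk_prob_reversible[of y] sum_distrib_left mult_ac)
  also have "\<dots> = (\<Sum>i\<le>n. real (n choose i) * (vmeasure w y * (\<Sum>x\<in>F. walk_prob w i y x)))"
    by (subst sum.swap) (simp add: sum_distrib_left)
  also have "\<dots> \<le> (\<Sum>i\<le>n. real (n choose i) * (vmeasure w y * 1))"
    by (intro sum_mono mult_left_mono sum_walk_prob_le_1 assms vmeasure_nonneg) auto
  also have "\<dots> = 2 ^ n * vmeasure w y"
    by (simp add: sum_binomial_real flip: sum_distrib_right)
  finally show ?thesis .
qed

text \<open>
With \<open>\<epsilon>\<^sub>N = \<Sum>n\<ge>N. (2t)\<^sup>n / n!\<close>, the remainder \<open>r\<^sub>N\<close> satisfies \<open>\<bar>r\<^sub>N\<bar> \<le> \<epsilon>\<^sub>N\<close> and \<open>\<Sum>\<bar>r\<^sub>N\<bar>\<mu> \<le> \<epsilon>\<^sub>N \<mu>(y)\<close>. Multiplying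
the two bounds, its \<open>\<ell>\<^sup>2(\<mu>)\<close> norm is at most \<open>\<epsilon>\<^sub>N \<mu>(y)\<^bsup>1/2\<^esup>\<close>.
\<close>

lemma heat_series_l2_remainder:
  fixes y :: "int ^ 'd"
  assumes "0 \<le> t"
  defines "r \<equiv> \<lambda>N x. (\<Sum>n<N. t ^ n / fact n * (laplacian w ^^ n) (indicator {y}) x)
      - poisson_avg t (\<lambda>n. walk_prob w n x y)"
  shows "r N \<in> l2 (vmeasure w)" and "(\<lambda>N. l2_norm (vmeasure w) (r N)) \<longlonglongrightarrow> 0"
proof -
  define v where "v x = poisson_avg t (\<lambda>n. walk_prob w n x y)" for x
  define \<delta> where "\<delta> n x = (laplacian w ^^ n) (indicator {y}) x" for n x
  define e where "e n = (2 * t) ^ n / fact n" for n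
  define \<epsilon> where "\<epsilon> N = (\<Sum>n. e (n + N))" for N
  have e0: "0 \<le> e n" for n
    using assms by (simp add: e_def)
  have es: "summable (\<lambda>n. e (n + N))" for N
    unfolding e_def by (intro summable_ignore_initial_segment summable_exp_series)
  have \<epsilon>0: "0 \<le> \<epsilon> N" for N
    unfolding \<epsilon>_def by (intro suminf_nonneg es e0)
  define q where "q N x n = \<bar>t ^ (n + N) / fact (n + N) * \<delta> (n + N) x\<bar>" for N x n
  have qs: "summable (q N x)" for N x
    unfolding q_def
    using summable_ignore_initial_segment[OF summable_exp_series_bounded[of "\<lambda>n. \<delta> n x" 2 t], of N]
    by (simp add: \<delta>_def laplacian_power_indicator_sup)
  have q_le: "q N x n \<le> e (n + N)" for N x n
  proof -
    have "t ^ (n + N) / fact (n + N) * \<bar>\<delta> (n + N) x\<bar> \<le> t ^ (n + N) / fact (n + N) * 2 ^ (n + N)"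
      using assms unfolding \<delta>_def by (intro mult_left_mono laplacian_power_indicator_sup) auto
    then show ?thesis
      using assms by (simp add: q_def e_def abs_mult power_mult_distrib mult.commute)
  qed
  have r_le: "\<bar>r N x\<bar> \<le> (\<Sum>n. q N x n)" for N x
  proof -
    have "summable (\<lambda>n. t ^ n / fact n * \<delta> n x)" "v x = (\<Sum>n. t ^ n / fact n * \<delta> n x)"
      using heat_series_sums[of t y x] by (auto simp: sums_iff v_def \<delta>_def)
    then have "r N x = - (\<Sum>n. t ^ (n + N) / fact (n + N) * \<delta> (n + N) x)"
      using suminf_split_initial_segment[of "\<lambda>n. t ^ n / fact n * \<delta> n x" N]
      by (simp add: r_def v_def \<delta>_def)
    then show ?thesis
      using summable_rabs[OF qs[unfolded q_def]] by (simp add: q_def)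
  qed
  have r_sup: "\<bar>r N x\<bar> \<le> \<epsilon> N" for N x
    using r_le[of N x] suminf_le[OF q_le qs es, of N x] by (simp add: \<epsilon>_def)
  have r_l1: "(\<Sum>x\<in>F. \<bar>r N x\<bar> * vmeasure w x) \<le> \<epsilon> N * vmeasure w y" if "finite F" for F N
  proof -
    have "(\<Sum>x\<in>F. \<bar>r N x\<bar> * vmeasure w x) \<le> (\<Sum>x\<in>F. (\<Sum>n. q N x n) * vmeasure w x)"
      by (intro sum_mono mult_right_mono r_le vmeasure_nonneg)
    also have "\<dots> = (\<Sum>x\<in>F. \<Sum>n. q N x n * vmeasure w x)"
      by (intro sum.cong refl suminf_mult2 qs)
    also have "\<dots> = (\<Sum>n. \<Sum>x\<in>F. q N x n * vmeasure w x)"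
      by (rule suminf_sum[symmetric]) (intro summable_mult2 qs)
    also have "\<dots> \<le> (\<Sum>n. e (n + N) * vmeasure w y)"
    proof (intro suminf_le summable_sum summable_mult2 qs es)
      fix n
      have "(\<Sum>x\<in>F. q N x n * vmeasure w x) =
          t ^ (n + N) / fact (n + N) * (\<Sum>x\<in>F. \<bar>\<delta> (n + N) x\<bar> * vmeasure w x)"
        using assms by (simp add: q_def abs_mult sum_distrib_left mult.assoc)
      also have "\<dots> \<le> t ^ (n + N) / fact (n + N) * (2 ^ (n + N) * vmeasure w y)"
        using assms unfolding \<delta>_def
        by (intro mult_left_mono laplacian_power_indicator_l1 that) auto
      finally show "(\<Sum>x\<in>F. q N x n * vmeasure w x) \<le> e (n + N) * vmeasure w y"
        by (simp add: e_def power_mult_distrib mult_ac)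
    qed
    also have "\<dots> = \<epsilon> N * vmeasure w y"
      unfolding \<epsilon>_def by (rule suminf_mult2[symmetric]) (rule es)
    finally show ?thesis .
  qed
  have r_l2: "(\<Sum>x\<in>F. (r N x)\<^sup>2 * vmeasure w x) \<le> (\<epsilon> N * sqrt (vmeasure w y))\<^sup>2"
    if "finite F" for F N
  proof -
    have "(\<Sum>x\<in>F. (r N x)\<^sup>2 * vmeasure w x) = (\<Sum>x\<in>F. \<bar>r N x\<bar> * (\<bar>r N x\<bar> * vmeasure w x))"
      by (simp add: power2_eq_square flip: mult.assoc)
    also have "\<dots> \<le> (\<Sum>x\<in>F. \<epsilon> N * (\<bar>r N x\<bar> * vmeasure w x))"
      by (intro sum_mono mult_right_mono r_sup mult_nonneg_nonneg vmeasure_nonneg) auto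
    also have "\<dots> \<le> \<epsilon> N * (\<epsilon> N * vmeasure w y)"
      unfolding sum_distrib_left[symmetric] by (intro mult_left_mono r_l1 \<epsilon>0 that)
    also have "\<dots> = (\<epsilon> N * sqrt (vmeasure w y))\<^sup>2"
      using vmeasure_nonneg[of y] by (simp add: power_mult_distrib power2_eq_square)
    finally show ?thesis .
  qed
  have B0: "0 \<le> \<epsilon> N * sqrt (vmeasure w y)" for N
    using \<epsilon>0 vmeasure_nonneg by simp
  show "r N \<in> l2 (vmeasure w)"
    by (rule l2_norm_le(1)[OF vmeasure_nonneg B0 r_l2])
  have "\<epsilon> \<longlonglongrightarrow> 0"
  proof -
    have "\<epsilon> = (\<lambda>N. exp (2 * t) - (\<Sum>n<N. e n))"
      using suminf_minus_initial_segment[OF es[of 0, simplified]]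
        sums_unique[OF exp_series_sums[of "2 * t"]]
      by (simp add: \<epsilon>_def e_def fun_eq_iff)
    moreover have "(\<lambda>N. exp (2 * t) - (\<Sum>n<N. e n)) \<longlonglongrightarrow> exp (2 * t) - exp (2 * t)"
      unfolding e_def using exp_series_sums[of "2 * t"]
      by (intro tendsto_diff tendsto_const) (simp add: sums_def)
    ultimately show ?thesis by simp
  qed
  then have lim: "(\<lambda>N. \<epsilon> N * sqrt (vmeasure w y)) \<longlonglongrightarrow> 0"
    by (rule tendsto_mult_left_zero)
  show "(\<lambda>N. l2_norm (vmeasure w) (r N)) \<longlonglongrightarrow> 0"
    by (rule tendsto_sandwich[OF _ _ tendsto_const lim])
       (auto simp: l2_norm_def intro!: always_eventually infsum_nonneg mult_nonneg_nonneg
          vmeasure_nonneg l2_norm_le(2)[OF vmeasure_nonneg B0 r_l2, unfolded l2_norm_def])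
qed

text \<open>
Convergence in \<open>\<ell>\<^sup>2(\<mu>)\<close> implies pointwise convergence because \<open>\<mu> > 0\<close>, so the limit in the definition of
the semigroup is unique and equals the pointwise sum of the series.
\<close>

lemma heat_semigroup_indicator:
  assumes "0 \<le> t"
  shows "heat_semigroup w t (indicator {y}) = (\<lambda>x. poisson_avg t (\<lambda>n. walk_prob w n x y))"
proof -
  define S where "S N x = (\<Sum>n<N. t ^ n / fact n * (laplacian w ^^ n) (indicator {y}) x)" for N x
  define v where "v = (\<lambda>x. poisson_avg t (\<lambda>n. walk_prob w n x y))"
  have r: "(\<lambda>x. S N x - v x) \<in> l2 (vmeasure w)" for N
    using heat_series_l2_remainder(1)[OF assms] by (simp add: S_def v_def)
  have lim: "(\<lambda>N. l2_norm (vmeasure w) (\<lambda>x. S N x - v x)) \<longlonglongrightarrow> 0"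
    using heat_series_l2_remainder(2)[OF assms] by (simp add: S_def v_def)
  \<comment> \<open>The empty partial sum vanishes, so the remainder at \<open>0\<close> is \<open>-v\<close>.\<close>
  have S_l2: "S N \<in> l2 (vmeasure w)" for N
  proof -
    have "(\<lambda>x. S N x - v x - (S 0 x - v x)) = S N"
      by (simp add: S_def[of 0])
    then show ?thesis
      using l2_diff[OF r[of N] r[of 0] vmeasure_nonneg] by simp
  qed
  have v_l2: "v \<in> l2 (vmeasure w)"
    using r[of 0] by (simp add: S_def l2_def)
  have unique: "u = v"
    if "u \<in> l2 (vmeasure w)" and u: "(\<lambda>N. l2_norm (vmeasure w) (\<lambda>x. S N x - u x)) \<longlonglongrightarrow> 0" for u
  proof
    fix x
    have m: "0 < sqrt (vmeasure w x)"
      using vmeasure_pos by simp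
    have "(\<lambda>N. (S N x - u x) * sqrt (vmeasure w x)) \<longlonglongrightarrow> 0"
      using l2_pointwise_le[OF l2_diff[OF S_l2 that(1) vmeasure_nonneg] vmeasure_nonneg] m
      by (intro Lim_null_comparison[OF _ u]) (auto simp: abs_mult)
    from tendsto_divide[OF this tendsto_const, of "sqrt (vmeasure w x)"]
    have "(\<lambda>N. S N x - u x) \<longlonglongrightarrow> 0"
      using m by simp
    then have "(\<lambda>N. S N x) \<longlonglongrightarrow> u x"
      by (rule LIM_zero_cancel)
    moreover have "(\<lambda>N. S N x) \<longlonglongrightarrow> v x"
      using heat_series_sums[of t y x] by (simp add: sums_def S_def v_def)
    ultimately show "u x = v x"
      by (rule LIMSEQ_unique)
  qed
  have "heat_semigroup w t (indicator {y}) = v"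
    unfolding heat_semigroup_def S_def[symmetric]
  proof (rule the_equality)
    show "v \<in> l2 (vmeasure w) \<and> (\<lambda>N. l2_norm (vmeasure w) (\<lambda>x. S N x - v x)) \<longlonglongrightarrow> 0"
      using v_l2 lim by (rule conjI)
    show "u = v"
      if "u \<in> l2 (vmeasure w) \<and> (\<lambda>N. l2_norm (vmeasure w) (\<lambda>x. S N x - u x)) \<longlonglongrightarrow> 0" for u
      using that by (elim conjE) (rule unique)
  qed
  then show ?thesis
    by (simp add: v_def)
qed

lemma heat_kernel_eq:
  assumes "0 \<le> t"
  shows "heat_kernel w t x y = poisson_avg t (\<lambda>n. walk_prob w n x y) / vmeasure w y"
  unfolding heat_kernel_def heat_semigroup_indicator[OF assms] divide_inverse by (rule mult.commute)

section \<open>The logarithmic weights\<close>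

lemma heat_kernel_integrable:
  assumes "x \<noteq> y"
  shows "set_integrable lborel {0<..1} (\<lambda>t. heat_kernel w t x y / t)"
proof -
  have "set_integrable lborel {0<..1} (\<lambda>t. poisson_avg t (\<lambda>n. walk_prob w n x y) / t)"
    using assms by (intro poisson_avg_integral(1)[where m = 1]) (auto simp: walk_prob_nonneg walk_prob_le_1)
  then have "set_integrable lborel {0<..1}
      (\<lambda>t. inverse (vmeasure w y) * (poisson_avg t (\<lambda>n. walk_prob w n x y) / t))"
    by (rule set_integrable_mult_right)
  also have "?this \<longleftrightarrow> ?thesis"
    by (intro set_integrable_cong refl) (simp add: heat_kernel_eq divide_inverse mult_ac)
  finally show ?thesis .
qed

lemma W_log_eq:
  "W_log w x y = vmeasure w x * (LBINT t:{0<..1}. poisson_avg t (\<lambda>n. walk_prob w n x y) / t)"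
proof -
  have "(LBINT t:{0<..1}. heat_kernel w t x y / t) =
      (LBINT t:{0<..1}. inverse (vmeasure w y) * (poisson_avg t (\<lambda>n. walk_prob w n x y) / t))"
    by (intro set_lebesgue_integral_cong) (auto simp: heat_kernel_eq divide_inverse mult_ac)
  then show ?thesis
    using vmeasure_pos[of y] by (simp only: W_log_def set_integral_mult_right) simp
qed

lemma heat_kernel_diagonal:
  assumes "t \<in> {0<..1}"
  shows "(1 - heat_kernel w t x x * vmeasure w x) / t =
    poisson_avg t (\<lambda>n. 1 - walk_prob w n x x) / t"
  using assms vmeasure_pos[of x]
  by (simp add: heat_kernel_eq poisson_avg_compl walk_prob_nonneg walk_prob_le_1)

lemma diagonal_integrable:
  "set_integrable lborel {0<..1} (\<lambda>t. (1 - heat_kernel w t x x * vmeasure w x) / t)"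
proof -
  have "set_integrable lborel {0<..1} (\<lambda>t. poisson_avg t (\<lambda>n. 1 - walk_prob w n x x) / t)"
    by (intro poisson_avg_integral(1)[where m = 1]) (auto simp: walk_prob_nonneg walk_prob_le_1)
  also have "?this \<longleftrightarrow> ?thesis"
    by (intro set_integrable_cong refl) (simp add: heat_kernel_diagonal)
  finally show ?thesis .
qed

text \<open>
The error of a finite partial sum is again an integral of a Poisson average. For finite \<open>F\<close> only finite
sums are exchanged with the integral.
\<close>

lemma W_log_remainder:
  assumes "finite F" "x \<notin> F"
  shows "vmeasure w x * (LBINT t:{0<..1}. (1 - heat_kernel w t x x * vmeasure w x) / t)
      - (\<Sum>y\<in>F. W_log w x y) =
    vmeasure w x *
      (LBINT t:{0<..1}. poisson_avg t (\<lambda>n. 1 - (\<Sum>y\<in>insert x F. walk_prob w n x y)) / t)"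
proof -
  let ?P = "\<lambda>y t. poisson_avg t (\<lambda>n. walk_prob w n x y) / t"
  let ?D = "\<lambda>t. (1 - heat_kernel w t x x * vmeasure w x) / t"
  let ?R = "\<lambda>t. poisson_avg t (\<lambda>n. 1 - (\<Sum>y\<in>insert x F. walk_prob w n x y)) / t"
  have P: "set_integrable lborel {0<..1} (?P y)" if "y \<in> F" for y
    using that assms(2)
    by (intro poisson_avg_integral(1)[where m = 1] walk_prob_nonneg walk_prob_le_1) auto
  have sumP: "set_integrable lborel {0<..1} (\<lambda>t. \<Sum>y\<in>F. ?P y t)"
    using P unfolding set_integrable_def scaleR_sum_right by (intro Bochner_Integration.integrable_sum)
  have "(\<Sum>y\<in>F. W_log w x y) = vmeasure w x * (LBINT t:{0<..1}. \<Sum>y\<in>F. ?P y t)"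
    using P unfolding W_log_eq sum_distrib_left[symmetric] set_lebesgue_integral_def
      set_integrable_def scaleR_sum_right
    by (subst Bochner_Integration.integral_sum) auto
  moreover have "(LBINT t:{0<..1}. ?D t) - (LBINT t:{0<..1}. \<Sum>y\<in>F. ?P y t) =
      (LBINT t:{0<..1}. ?D t - (\<Sum>y\<in>F. ?P y t))"
    by (rule set_integral_diff(2)[symmetric, OF diagonal_integrable sumP])
  moreover have "\<dots> = (LBINT t:{0<..1}. ?R t)"
  proof (intro set_lebesgue_integral_cong, simp, intro allI impI)
    fix t :: real assume t: "t \<in> {0<..1}"
    have "poisson_avg t (\<lambda>n. 1 - (\<Sum>y\<in>insert x F. walk_prob w n x y)) =
        1 - (\<Sum>y\<in>insert x F. poisson_avg t (\<lambda>n. walk_prob w n x y))"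
      using assms(1)
      by (subst poisson_avg_compl)
         (auto intro!: sum_nonneg walk_prob_nonneg sum_walk_prob_le_1 poisson_avg_sum walk_prob_le_1
           simp del: sum.insert)
    then show "?D t - (\<Sum>y\<in>F. ?P y t) = ?R t"
      using assms t
      by (simp only: heat_kernel_diagonal poisson_avg_compl walk_prob_nonneg walk_prob_le_1)
         (simp add: diff_divide_distrib add_divide_distrib sum_divide_distrib)
  qed
  ultimately show ?thesis
    by (simp flip: right_diff_distrib)
qed

lemma W_log_has_sum:
  "((\<lambda>y. W_log w x y) has_sum
     (vmeasure w x * (LBINT t:{0<..1}. (1 - heat_kernel w t x x * vmeasure w x) / t))) {y. y \<noteq> x}"
  (is "(_ has_sum ?T) _")
  unfolding has_sum_def
proof (rule tendstoI)
  fix \<epsilon> :: real assume "0 < \<epsilon>"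
  \<comment> \<open>The error will be at most \<open>\<mu>(x) / m\<close>.\<close>
  obtain m :: nat where m: "vmeasure w x / \<epsilon> < real m" "0 < m"
    using reals_Archimedean2[of "max 0 (vmeasure w x / \<epsilon>)"] by auto
  have "\<forall>n. \<exists>S. finite S \<and> (\<forall>F. finite F \<longrightarrow> S \<subseteq> F \<longrightarrow> (\<Sum>y\<in>F. walk_prob w n x y) = 1)"
    using ex_finite_walk_range by (rule allI)
  from choice[OF this] obtain S where "\<forall>n. finite (S n) \<and>
      (\<forall>F. finite F \<longrightarrow> S n \<subseteq> F \<longrightarrow> (\<Sum>y\<in>F. walk_prob w n x y) = 1)"
    by (rule exE)
  then have S: "finite (S n)"
    "finite F \<Longrightarrow> S n \<subseteq> F \<Longrightarrow> (\<Sum>y\<in>F. walk_prob w n x y) = 1" for n F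
    by auto
  let ?X = "(\<Union>n<m. S n) - {x}"
  have "dist (\<Sum>y\<in>F. W_log w x y) ?T < \<epsilon>" if F: "finite F" "?X \<subseteq> F" "F \<subseteq> {y. y \<noteq> x}" for F
  proof -
    let ?a = "\<lambda>n. 1 - (\<Sum>y\<in>insert x F. walk_prob w n x y)"
    let ?I = "LBINT t:{0<..1}. poisson_avg t ?a / t"
    have a: "0 \<le> ?a n" "?a n \<le> 1" for n
      using sum_walk_prob_le_1[of "insert x F" n x] F(1) sum_nonneg[of "insert x F" "walk_prob w n x"]
      by (auto simp: walk_prob_nonneg simp del: sum.insert)
    have zero: "?a n = 0" if "n < m" for n
    proof -
      have "S n \<subseteq> insert x F"
        using that F(2) by blast
      then show ?thesis
        using S(2)[of "insert x F" n] F(1) by simp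
    qed
    have "x \<notin> F"
      using F(3) by blast
    note rem = W_log_remainder[OF F(1) this]
    note I = poisson_avg_integral(2,3)[of ?a m, OF a zero m(2)]
    have "1 / (real m * fact m) \<le> 1 / real m"
      using m(2) by (simp add: field_simps)
    then have "vmeasure w x * ?I \<le> vmeasure w x * (1 / real m)"
      using I by (intro mult_left_mono vmeasure_nonneg) linarith
    also have "\<dots> < \<epsilon>"
      using m \<open>0 < \<epsilon>\<close> by (simp add: field_simps)
    finally have "vmeasure w x * ?I < \<epsilon>" .
    moreover have "0 \<le> vmeasure w x * ?I"
      using I vmeasure_nonneg by simp
    ultimately show ?thesis
      using rem by (simp add: dist_real_def)
  qed
  then show "\<forall>\<^sub>F F in finite_subsets_at_top {y. y \<noteq> x}. dist (\<Sum>y\<in>F. W_log w x y) ?T < \<epsilon>"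
    unfolding eventually_finite_subsets_at_top
    using S(1) by (intro exI[of _ ?X]) auto
qed

lemma W_log_le:
  assumes "x \<noteq> y" and M: "vmeasure w x \<le> M"
  shows "W_log w x y \<le>
    M * (exp (real (graph_dist x y)) / real (graph_dist x y) ^ (graph_dist x y + 1))"
proof (cases "graph_dist x y = 0")
  case True
  \<comment> \<open>The right-hand side is then \<open>0\<close>, by division by zero. If \<open>y\<close> were reachable from \<open>x\<close>, distance \<open>0\<close>
    would force \<open>x = y\<close>; so no walk joins the two points and the left-hand side is \<open>0\<close> too.\<close>
  have "walk_prob w n x y = 0" for n
  proof (rule ccontr)
    assume "walk_prob w n x y \<noteq> 0"
    then have "(lattice_adj ^^ graph_dist x y) x y"
      unfolding graph_dist_def by (rule LeastI[OF walk_prob_path])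
    with True \<open>x \<noteq> y\<close> show False
      by simp
  qed
  then show ?thesis
    using M vmeasure_nonneg[of x] True by (simp add: W_log_eq poisson_avg_def)
next
  case False
  define d where "d = graph_dist x y"
  have d: "0 < d"
    using False by (simp add: d_def)
  let ?I = "LBINT t:{0<..1}. poisson_avg t (\<lambda>n. walk_prob w n x y) / t"
  have I: "0 \<le> ?I" "?I \<le> 1 / (real d * fact d)"
    using d by (intro poisson_avg_integral(2,3) walk_prob_nonneg walk_prob_le_1 walk_prob_eq_0;
      simp add: d_def)+
  \<comment> \<open>The term of index \<open>d\<close> of the series of \<open>e\<^sup>d\<close>.\<close>
  have "real d ^ d / fact d \<le> exp (real d)"
    using sum_le_suminf[OF summable_exp_series, of "{d}" "real d"]
      sums_unique[OF exp_series_sums[of "real d"]] by simp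
  then have "1 / (real d * fact d) \<le> exp (real d) / real d ^ (d + 1)"
    using d by (simp add: field_simps)
  with I have "?I \<le> exp (real d) / real d ^ (d + 1)"
    by linarith
  then have "W_log w x y \<le> M * (exp (real d) / real d ^ (d + 1))"
    unfolding W_log_eq using M I(1) vmeasure_nonneg[of x] by (intro mult_mono) auto
  then show ?thesis
    by (simp add: d_def)
qed

end

theorem proposition1p2:
  fixes w :: "int ^ 'd \<Rightarrow> int ^ 'd \<Rightarrow> real"
  assumes "lattice_weight w"
    and "0 < mu_min w" and "mu_min w \<le> mu_max w" and "mu_max w < \<infinity>"
    and "0 < (INF (x, y) \<in> {(x, y). lattice_adj x y}. ereal (w x y))"
  shows "(\<forall>x y. x \<noteq> y \<longrightarrow>
            set_integrable lborel {0<..1} (\<lambda>t. heat_kernel w t x y / t)) \<and>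
         (\<forall>x. set_integrable lborel {0<..1}
                (\<lambda>t. (1 - heat_kernel w t x x * vmeasure w x) / t)) \<and>
         (\<forall>x. ((\<lambda>y. W_log w x y) has_sum
                (vmeasure w x *
                  (LBINT t:{0<..1}. (1 - heat_kernel w t x x * vmeasure w x) / t)))
              {y. y \<noteq> x}) \<and>
         (\<exists>C>0. \<forall>x y. x \<noteq> y \<longrightarrow>
            W_log w x y \<le>
              C * (exp (real (graph_dist x y)) /
                   real (graph_dist x y) ^ (graph_dist x y + 1)))"
proof -
  have pos: "0 < vmeasure w x" for x
  proof -
    have "mu_min w \<le> ereal (vmeasure w x)"
      unfolding mu_min_def by (rule INF_lower) simp
    with assms(2) show ?thesis
      using less_le_trans by fastforce
  qed
  interpret positive_lattice_weight w
    using assms(1) pos by unfold_locales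
  have le: "ereal (vmeasure w x) \<le> mu_max w" for x
    unfolding mu_max_def by (rule SUP_upper) simp
  define M where "M = real_of_ereal (mu_max w)"
  have "mu_max w = ereal M"
    using assms(4) le[of 0] unfolding M_def by (cases "mu_max w") auto
  then have M: "vmeasure w x \<le> M" for x
    using le[of x] by simp
  have "0 < M"
    using pos[of 0] M[of 0] by linarith
  then show ?thesis
    using heat_kernel_integrable diagonal_integrable W_log_has_sum W_log_le[OF _ M] by blast
qed

end
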